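(* Let $\mathcal{L}$ be a first-order language and let $\mathcal{K}=(K,\leq,D,\Vdash)$ be a Kripke model for $\mathcal{L}$ of finite depth. Then for every node $\alpha\in K$ there exists a sentence $\rho\in{\sf PEM}(\mathcal{L})^*$ such that for every sentence $A$ of $\mathcal{L}(D(\alpha))$, $$\alpha\Vdash A^{\rho}\quad\text{iff}\quad \alpha\models A.$$
   Context: A Kripke model for a first-order language $\mathcal{L}$ is a quadruple $\mathcal{K}=(K,\leq,D,\Vdash)$ where $(K,\leq)$ is a nonempty poset, $D$ assigns to each node $\alpha$ a nonempty set $D(\alpha)$ with $D(\alpha)\subseteq D(\beta)$ whenever $\alpha\leq\beta$, and $\Vdash$ relates each node $\alpha$ to atomic sentences of $\mathcal{L}(D(\alpha))$ ($\mathcal{L}$ expanded by constants for the elements of $D(\alpha)$), monotonically: if $\alpha\leq\beta$ and $\alpha\Vdash A$ then $\beta\Vdash A$. Forcing is extended to all sentences in the standard intuitionistic way ($\bot$ is never forced; $\wedge,\vee,\exists$ are evaluated locally; $\alpha\Vdash A\to B$ iff for all $\beta\geq\alpha$, $\beta\Vdash A$ implies $\beta\Vdash B$; $\alpha\Vdash\forall x A$ iff for all $\beta\geq\alpha$ and $b\in D(\beta)$, $\beta\Vdash A[x:b]$). Each node $\alpha$ determines a classical structure $\mathfrak{M}_\alpha$ for $\mathcal{L}(D(\alpha))$ with universe $D(\alpha)$ in which an atomic sentence is true iff it is forced at $\alpha$; $\alpha\models A$ means $\mathfrak{M}_\alpha\models A$. The depth $d(\mathcal{K})$ is the maximum natural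 number $n$ such that no path (chain) in $(K,\leq)$ is longer than $n$; $\mathcal{K}$ has finite depth if such $n$ exists. For a sentence $\rho$, the Friedman translation $A^\rho$ of a formula $A$ is defined by: $A^\rho:=A\vee\rho$ for atomic $A$ (including $\bot$), $(A_1\circ A_2)^\rho:=A_1^\rho\circ A_2^\rho$ for $\circ\in\{\wedge,\vee,\to\}$, $(\forall xA)^\rho:=\forall x(A^\rho)$, $(\exists xA)^\rho:=\exists x(A^\rho)$ ($\neg A$ abbreviates $A\to\bot$). ${\sf PEM}(\mathcal{L})$ is the set of universal closures of all formulas $A\vee\neg A$ with $A$ a formula of $\mathcal{L}$. For a set of formulas $\Gamma$, $\Gamma^*=\bigcup_n\Gamma^n$ where $\Gamma^0=\{\bot\}$ and $\Gamma^{n+1}=\{A^B: A\in\Gamma^n,\ B\in\Gamma\}$. *)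

theory Defs
  imports Main
begin

text \<open>
  A language is given by sets of function and predicate symbols with arities; either set may be
  empty, and nullary function symbols are the constants of the language. Equality is not a logical
  symbol: a language with equality has it among its predicate symbols.
\<close>

record ('f, 'p) language =
  fsyms :: "'f set"
  farity :: "'f \<Rightarrow> nat"
  psyms :: "'p set"
  parity :: "'p \<Rightarrow> nat"

text \<open>
  \<open>Cst d\<close> is the name of a domain element \<open>d\<close>. The formulas of the language itself are those without
  such names.
\<close>

datatype ('f, 'd) tm = Var nat | Cst 'd | Fn 'f "('f, 'd) tm list"

datatype ('f, 'p, 'd) fm =
    Bot
  | Atom 'p "('f, 'd) tm list"
  | And "('f, 'p, 'd) fm" "('f, 'p, 'd) fm"
  | Or "('f, 'p, 'd) fm" "('f, 'p, 'd) fm"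
  | Imp "('f, 'p, 'd) fm" "('f, 'p, 'd) fm"
  | Forall nat "('f, 'p, 'd) fm"
  | Exists nat "('f, 'p, 'd) fm"

abbreviation Neg :: "('f, 'p, 'd) fm \<Rightarrow> ('f, 'p, 'd) fm" where
  "Neg A \<equiv> Imp A Bot"

primrec fv_tm :: "('f, 'd) tm \<Rightarrow> nat set" where
  "fv_tm (Var x) = {x}"
| "fv_tm (Cst d) = {}"
| "fv_tm (Fn f ts) = \<Union> (set (map fv_tm ts))"

primrec fv :: "('f, 'p, 'd) fm \<Rightarrow> nat set" where
  "fv Bot = {}"
| "fv (Atom p ts) = \<Union> (set (map fv_tm ts))"
| "fv (And A B) = fv A \<union> fv B"
| "fv (Or A B) = fv A \<union> fv B"
| "fv (Imp A B) = fv A \<union> fv B"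
| "fv (Forall x A) = fv A - {x}"
| "fv (Exists x A) = fv A - {x}"

text \<open>Terms and formulas of the language \<open>L\<close> expanded by names for the elements of \<open>U\<close>.\<close>

primrec tm_of :: "('f, 'p) language \<Rightarrow> 'd set \<Rightarrow> ('f, 'd) tm \<Rightarrow> bool" where
  "tm_of L U (Var x) \<longleftrightarrow> True"
| "tm_of L U (Cst d) \<longleftrightarrow> d \<in> U"
| "tm_of L U (Fn f ts) \<longleftrightarrow> f \<in> fsyms L \<and> length ts = farity L f \<and> list_all (tm_of L U) ts"

primrec fm_of :: "('f, 'p) language \<Rightarrow> 'd set \<Rightarrow> ('f, 'p, 'd) fm \<Rightarrow> bool" where
  "fm_of L U Bot \<longleftrightarrow> True"
| "fm_of L U (Atom p ts) \<longleftrightarrow> p \<in> psyms L \<and> length ts = parity L p \<and> list_all (tm_of L U) ts"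
| "fm_of L U (And A B) \<longleftrightarrow> fm_of L U A \<and> fm_of L U B"
| "fm_of L U (Or A B) \<longleftrightarrow> fm_of L U A \<and> fm_of L U B"
| "fm_of L U (Imp A B) \<longleftrightarrow> fm_of L U A \<and> fm_of L U B"
| "fm_of L U (Forall x A) \<longleftrightarrow> fm_of L U A"
| "fm_of L U (Exists x A) \<longleftrightarrow> fm_of L U A"

definition sentence_of :: "('f, 'p) language \<Rightarrow> 'd set \<Rightarrow> ('f, 'p, 'd) fm \<Rightarrow> bool" where
  "sentence_of L U A \<longleftrightarrow> fm_of L U A \<and> fv A = {}"

text \<open>\<open>inst x d A\<close> is \<open>A[x:d]\<close>.\<close>

primrec inst_tm :: "nat \<Rightarrow> 'd \<Rightarrow> ('f, 'd) tm \<Rightarrow> ('f, 'd) tm" where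
  "inst_tm x d (Var y) = (if y = x then Cst d else Var y)"
| "inst_tm x d (Cst c) = Cst c"
| "inst_tm x d (Fn f ts) = Fn f (map (inst_tm x d) ts)"

primrec inst :: "nat \<Rightarrow> 'd \<Rightarrow> ('f, 'p, 'd) fm \<Rightarrow> ('f, 'p, 'd) fm" where
  "inst x d Bot = Bot"
| "inst x d (Atom p ts) = Atom p (map (inst_tm x d) ts)"
| "inst x d (And A B) = And (inst x d A) (inst x d B)"
| "inst x d (Or A B) = Or (inst x d A) (inst x d B)"
| "inst x d (Imp A B) = Imp (inst x d A) (inst x d B)"
| "inst x d (Forall y A) = (if y = x then Forall y A else Forall y (inst x d A))"
| "inst x d (Exists y A) = (if y = x then Exists y A else Exists y (inst x d A))"

primrec height :: "('f, 'p, 'd) fm \<Rightarrow> nat" where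
  "height Bot = 0"
| "height (Atom p ts) = 0"
| "height (And A B) = Suc (max (height A) (height B))"
| "height (Or A B) = Suc (max (height A) (height B))"
| "height (Imp A B) = Suc (max (height A) (height B))"
| "height (Forall x A) = Suc (height A)"
| "height (Exists x A) = Suc (height A)"

lemma height_inst [simp]: "height (inst x d A) = height A"
  by (induction A) auto

text \<open>
  Classical structures, and truth of sentences of the language expanded by names for the elements
  of the universe; each name denotes the element it names.
\<close>

record ('f, 'p, 'd) struct =
  univ :: "'d set"
  fint :: "'f \<Rightarrow> 'd list \<Rightarrow> 'd"
  pint :: "'p \<Rightarrow> 'd list \<Rightarrow> bool"

primrec val :: "('f, 'p, 'd) struct \<Rightarrow> ('f, 'd) tm \<Rightarrow> 'd" where
  "val M (Var x) = undefined"
| "val M (Cst d) = d"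
| "val M (Fn f ts) = fint M f (map (val M) ts)"

function holds :: "('f, 'p, 'd) struct \<Rightarrow> ('f, 'p, 'd) fm \<Rightarrow> bool" where
  "holds M Bot \<longleftrightarrow> False"
| "holds M (Atom p ts) \<longleftrightarrow> pint M p (map (val M) ts)"
| "holds M (And A B) \<longleftrightarrow> holds M A \<and> holds M B"
| "holds M (Or A B) \<longleftrightarrow> holds M A \<or> holds M B"
| "holds M (Imp A B) \<longleftrightarrow> (holds M A \<longrightarrow> holds M B)"
| "holds M (Forall x A) \<longleftrightarrow> (\<forall>d\<in>univ M. holds M (inst x d A))"
| "holds M (Exists x A) \<longleftrightarrow> (\<exists>d\<in>univ M. holds M (inst x d A))"
  by pat_completeness auto
termination
  by (relation "measure (\<lambda>(M, A). height A)") auto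

text \<open>
  \<open>frc\<close> is the forcing relation between nodes and atomic sentences, and \<open>fun_at K \<alpha>\<close> interprets the
  function symbols in the classical structure at \<open>\<alpha>\<close>, which \<open>D\<close> and \<open>\<Vdash>\<close> alone do not provide when the
  language has function symbols.
\<close>

record ('k, 'f, 'p, 'd) kripke =
  nodes :: "'k set"
  leq :: "('k \<times> 'k) set"
  dmn :: "'k \<Rightarrow> 'd set"
  fun_at :: "'k \<Rightarrow> 'f \<Rightarrow> 'd list \<Rightarrow> 'd"
  frc :: "'k \<Rightarrow> 'p \<Rightarrow> ('f, 'd) tm list \<Rightarrow> bool"

definition struct_at :: "('k, 'f, 'p, 'd) kripke \<Rightarrow> 'k \<Rightarrow> ('f, 'p, 'd) struct" where
  "struct_at K \<alpha> =
     \<lparr>univ = dmn K \<alpha>, fint = fun_at K \<alpha>, pint = (\<lambda>p ds. frc K \<alpha> p (map Cst ds))\<rparr>"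

text \<open>
  The last two conditions say that \<open>struct_at K \<alpha>\<close> is a structure in which exactly the atomic sentences
  forced at \<open>\<alpha>\<close> are true; they are void if there are no function symbols.
  That \<open>fun_at K \<beta>\<close> extends \<open>fun_at K \<alpha>\<close> for \<open>\<alpha> \<le> \<beta>\<close> is not demanded beyond what monotonicity of
  forcing gives, so that equality may also be interpreted by a congruence growing along \<open>\<le>\<close>.
\<close>

definition kripke_model :: "('f, 'p) language \<Rightarrow> ('k, 'f, 'p, 'd) kripke \<Rightarrow> bool" where
  "kripke_model L K \<longleftrightarrow>
     nodes K \<noteq> {} \<and> partial_order_on (nodes K) (leq K) \<and>
     (\<forall>\<alpha>\<in>nodes K. dmn K \<alpha> \<noteq> {}) \<and>
     (\<forall>\<alpha> \<beta>. (\<alpha>, \<beta>) \<in> leq K \<longrightarrow> dmn K \<alpha> \<subseteq> dmn K \<beta>) \<and>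
     (\<forall>\<alpha> \<beta> p ts. (\<alpha>, \<beta>) \<in> leq K \<longrightarrow> sentence_of L (dmn K \<alpha>) (Atom p ts) \<longrightarrow>
        frc K \<alpha> p ts \<longrightarrow> frc K \<beta> p ts) \<and>
     (\<forall>\<alpha>\<in>nodes K. \<forall>f\<in>fsyms L. \<forall>ds. length ds = farity L f \<longrightarrow> set ds \<subseteq> dmn K \<alpha> \<longrightarrow>
        fun_at K \<alpha> f ds \<in> dmn K \<alpha>) \<and>
     (\<forall>\<alpha>\<in>nodes K. \<forall>p ts. sentence_of L (dmn K \<alpha>) (Atom p ts) \<longrightarrow>
        (holds (struct_at K \<alpha>) (Atom p ts) \<longleftrightarrow> frc K \<alpha> p ts))"

function forces :: "('k, 'f, 'p, 'd) kripke \<Rightarrow> 'k \<Rightarrow> ('f, 'p, 'd) fm \<Rightarrow> bool" where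
  "forces K \<alpha> Bot \<longleftrightarrow> False"
| "forces K \<alpha> (Atom p ts) \<longleftrightarrow> frc K \<alpha> p ts"
| "forces K \<alpha> (And A B) \<longleftrightarrow> forces K \<alpha> A \<and> forces K \<alpha> B"
| "forces K \<alpha> (Or A B) \<longleftrightarrow> forces K \<alpha> A \<or> forces K \<alpha> B"
| "forces K \<alpha> (Imp A B) \<longleftrightarrow>
     (\<forall>\<beta>\<in>nodes K. (\<alpha>, \<beta>) \<in> leq K \<longrightarrow> forces K \<beta> A \<longrightarrow> forces K \<beta> B)"
| "forces K \<alpha> (Forall x A) \<longleftrightarrow>
     (\<forall>\<beta>\<in>nodes K. (\<alpha>, \<beta>) \<in> leq K \<longrightarrow> (\<forall>d\<in>dmn K \<beta>. forces K \<beta> (inst x d A)))"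
| "forces K \<alpha> (Exists x A) \<longleftrightarrow> (\<exists>d\<in>dmn K \<alpha>. forces K \<alpha> (inst x d A))"
  by pat_completeness auto
termination
  by (relation "measure (\<lambda>(K, \<alpha>, A). height A)") auto

definition finite_depth :: "('k, 'f, 'p, 'd) kripke \<Rightarrow> bool" where
  "finite_depth K \<longleftrightarrow> (\<exists>n. \<forall>C\<in>Chains (leq K). finite C \<and> card C \<le> n)"

text \<open>
  \<open>friedman A \<rho>\<close> is \<open>A\<^sup>\<rho>\<close>. It is only meant for sentences \<open>\<rho>\<close>, for which no variable capture can occur.
\<close>

primrec friedman :: "('f, 'p, 'd) fm \<Rightarrow> ('f, 'p, 'd) fm \<Rightarrow> ('f, 'p, 'd) fm" where
  "friedman Bot \<rho> = Or Bot \<rho>"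
| "friedman (Atom p ts) \<rho> = Or (Atom p ts) \<rho>"
| "friedman (And A B) \<rho> = And (friedman A \<rho>) (friedman B \<rho>)"
| "friedman (Or A B) \<rho> = Or (friedman A \<rho>) (friedman B \<rho>)"
| "friedman (Imp A B) \<rho> = Imp (friedman A \<rho>) (friedman B \<rho>)"
| "friedman (Forall x A) \<rho> = Forall x (friedman A \<rho>)"
| "friedman (Exists x A) \<rho> = Exists x (friedman A \<rho>)"

definition univ_closure :: "('f, 'p, 'd) fm \<Rightarrow> ('f, 'p, 'd) fm" where
  "univ_closure A = foldr Forall (sorted_list_of_set (fv A)) A"

definition PEM :: "('f, 'p) language \<Rightarrow> ('f, 'p, 'd) fm set" where
  "PEM L = {univ_closure (Or A (Neg A)) | A. fm_of L {} A}"

primrec friedman_pow :: "('f, 'p, 'd) fm set \<Rightarrow> nat \<Rightarrow> ('f, 'p, 'd) fm set" where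
  "friedman_pow \<Gamma> 0 = {Bot}"
| "friedman_pow \<Gamma> (Suc n) = {friedman A B | A B. A \<in> friedman_pow \<Gamma> n \<and> B \<in> \<Gamma>}"

definition friedman_star :: "('f, 'p, 'd) fm set \<Rightarrow> ('f, 'p, 'd) fm set" where
  "friedman_star \<Gamma> = (\<Union>n. friedman_pow \<Gamma> n)"

end

theory Submission
  imports Defs
begin

text \<open>
  Let \<open>\<rho>\<close> be a sentence that is not forced at \<open>\<alpha>\<close>. A node not forcing \<open>\<rho>\<close> forces \<open>A\<^sup>\<rho>\<close> iff it forces \<open>A\<close> in
  the submodel of all nodes that do not force \<open>\<rho>\<close>. If \<open>\<alpha>\<close> forces every instance of \<open>PEM\<close>, then forcing
  at \<open>\<alpha>\<close> is classical truth at \<open>\<alpha>\<close>, and \<open>\<rho> = \<bottom>\<close> works. Otherwise pass to the submodel of the nodes not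
  forcing some \<open>C \<in> PEM\<close> that fails at \<open>\<alpha>\<close>. Maximal nodes force \<open>PEM\<close>, so every chain of this submodel
  can be prolonged in the original model and the depth drops. By induction there is a suitable \<open>\<rho>'\<close> for
  the submodel, and \<open>\<rho> = \<rho>'\<^sup>C\<close> is suitable for the original model because \<open>(A\<^sup>\<rho>\<^sup>')\<^sup>C\<close> and \<open>A\<^sup>\<rho>\<close> are
  equivalent.
\<close>

section \<open>Instances of sentences\<close>

lemma finite_fv_tm [simp]: "finite (fv_tm t)"
  by (induction t) auto

lemma finite_fv [simp]: "finite (fv A)"
  by (induction A) auto

lemma tm_of_mono: "tm_of L U t \<Longrightarrow> U \<subseteq> V \<Longrightarrow> tm_of L V t"
  by (induction t) (auto simp: list_all_iff)

lemma fm_of_mono: "fm_of L U A \<Longrightarrow> U \<subseteq> V \<Longrightarrow> fm_of L V A"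
  by (induction A) (auto simp: list_all_iff tm_of_mono)

lemma sentence_of_mono: "sentence_of L U A \<Longrightarrow> U \<subseteq> V \<Longrightarrow> sentence_of L V A"
  by (auto simp: sentence_of_def fm_of_mono)

lemma tm_of_inst_tm: "tm_of L U t \<Longrightarrow> d \<in> U \<Longrightarrow> tm_of L U (inst_tm x d t)"
  by (induction t) (auto simp: list_all_iff)

lemma fm_of_inst: "fm_of L U A \<Longrightarrow> d \<in> U \<Longrightarrow> fm_of L U (inst x d A)"
  by (induction A) (auto simp: list_all_iff tm_of_inst_tm)

lemma fv_tm_inst_tm: "fv_tm (inst_tm x d t) = fv_tm t - {x}"
  by (induction t) auto

lemma fv_inst: "fv (inst x d A) = fv A - {x}"
  by (induction A) (auto simp: fv_tm_inst_tm)

lemma inst_tm_idle: "x \<notin> fv_tm t \<Longrightarrow> inst_tm x d t = t"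
  by (induction t) (auto intro: map_idI)

lemma inst_idle: "x \<notin> fv A \<Longrightarrow> inst x d A = A"
  by (induction A) (auto simp: inst_tm_idle intro!: map_idI)

lemma sentence_of_simps [simp]:
  "sentence_of L U Bot"
  "sentence_of L U (And A B) \<longleftrightarrow> sentence_of L U A \<and> sentence_of L U B"
  "sentence_of L U (Or A B) \<longleftrightarrow> sentence_of L U A \<and> sentence_of L U B"
  "sentence_of L U (Imp A B) \<longleftrightarrow> sentence_of L U A \<and> sentence_of L U B"
  by (auto simp: sentence_of_def)

lemma sentence_of_inst:
  "sentence_of L U (Forall x A) \<Longrightarrow> d \<in> U \<Longrightarrow> sentence_of L U (inst x d A)"
  "sentence_of L U (Exists x A) \<Longrightarrow> d \<in> U \<Longrightarrow> sentence_of L U (inst x d A)"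
  by (auto simp: sentence_of_def fm_of_inst fv_inst)

text \<open>Forcing and truth of a quantified formula refer to the formulas
  \<open>inst x d A\<close>, which need not be subformulas but have smaller height; hence induction
  on \<open>height\<close> instead of structural induction.\<close>

lemma fm_height_induct [case_names Bot Atom And Or Imp Forall Exists]:
  assumes "P Bot" and "\<And>p ts. P (Atom p ts)"
    and "\<And>A B. P A \<Longrightarrow> P B \<Longrightarrow> P (And A B)"
    and "\<And>A B. P A \<Longrightarrow> P B \<Longrightarrow> P (Or A B)"
    and "\<And>A B. P A \<Longrightarrow> P B \<Longrightarrow> P (Imp A B)"
    and "\<And>x A. (\<And>d. P (inst x d A)) \<Longrightarrow> P (Forall x A)"
    and "\<And>x A. (\<And>d. P (inst x d A)) \<Longrightarrow> P (Exists x A)"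
  shows "P A"
proof (induction A rule: measure_induct_rule[of height])
  case (less A)
  then show ?case
    by (cases A) (auto intro!: assms)
qed

section \<open>The Friedman translation\<close>

lemma inst_friedman:
  "fv \<rho> = {} \<Longrightarrow> inst x d (friedman A \<rho>) = friedman (inst x d A) \<rho>"
  by (induction A) (auto simp: inst_idle)

lemma sentence_of_friedman:
  assumes "sentence_of L U A" and "sentence_of L U \<rho>"
  shows "sentence_of L U (friedman A \<rho>)"
proof -
  have "fm_of L U A \<Longrightarrow> fm_of L U (friedman A \<rho>)" "fv (friedman A \<rho>) \<subseteq> fv A"
    using assms(2) by (induction A) (auto simp: sentence_of_def)
  then show ?thesis
    using assms by (auto simp: sentence_of_def)
qed

section \<open>Order, domains and persistence of forcing\<close>

lemma leq_nodes:
  assumes "kripke_model L K" and "(\<alpha>, \<beta>) \<in> leq K"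
  shows "\<alpha> \<in> nodes K" and "\<beta> \<in> nodes K"
  using assms by (auto simp: kripke_model_def partial_order_on_def preorder_on_def)

lemma leq_refl: "kripke_model L K \<Longrightarrow> \<alpha> \<in> nodes K \<Longrightarrow> (\<alpha>, \<alpha>) \<in> leq K"
  by (auto simp: kripke_model_def partial_order_on_def preorder_on_def refl_on_def)

lemma leq_trans:
  "kripke_model L K \<Longrightarrow> (\<alpha>, \<beta>) \<in> leq K \<Longrightarrow> (\<beta>, \<gamma>) \<in> leq K \<Longrightarrow> (\<alpha>, \<gamma>) \<in> leq K"
  unfolding kripke_model_def partial_order_on_def preorder_on_def by (meson transD)

lemma dmn_mono: "kripke_model L K \<Longrightarrow> (\<alpha>, \<beta>) \<in> leq K \<Longrightarrow> dmn K \<alpha> \<subseteq> dmn K \<beta>"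
  by (simp add: kripke_model_def)

lemma dmn_nonempty: "kripke_model L K \<Longrightarrow> \<alpha> \<in> nodes K \<Longrightarrow> \<exists>d. d \<in> dmn K \<alpha>"
  by (auto simp: kripke_model_def)

lemma forces_mono:
  assumes K: "kripke_model L K"
  shows "(\<alpha>, \<beta>) \<in> leq K \<Longrightarrow> sentence_of L (dmn K \<alpha>) A \<Longrightarrow> forces K \<alpha> A \<Longrightarrow> forces K \<beta> A"
proof (induction A rule: fm_height_induct)
  case (Atom p ts)
  with K show ?case by (simp add: kripke_model_def)
next
  case (Exists x A)
  then show ?case
    using dmn_mono[OF K] sentence_of_inst(2) by fastforce
qed (auto dest: leq_trans[OF K])

text \<open>Every atomic part of the translation, \<open>Bot\<close> included, carries the disjunct
  \<open>\<rho>\<close>. Persistence of \<open>\<rho>\<close> handles implication and universal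
  quantification, nonempty domains the existential case.\<close>

lemma forces_friedman_of_forces:
  assumes K: "kripke_model L K" and \<rho>: "sentence_of L {} \<rho>"
  shows "\<beta> \<in> nodes K \<Longrightarrow> forces K \<beta> \<rho> \<Longrightarrow> forces K \<beta> (friedman A \<rho>)"
proof (induction A arbitrary: \<beta> rule: fm_height_induct)
  case (Imp A B)
  then show ?case
    using forces_mono[OF K _ sentence_of_mono[OF \<rho>]] by auto
next
  case (Forall x A)
  then show ?case
    using forces_mono[OF K _ sentence_of_mono[OF \<rho>]] \<rho>
    by (auto simp: inst_friedman sentence_of_def)
next
  case (Exists x A)
  then show ?case
    using dmn_nonempty[OF K] \<rho> by (auto simp: inst_friedman sentence_of_def)
qed auto

text \<open>Only the atomic cases need an argument: translating \<open>Or P \<rho>\<close> by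
  \<open>\<tau>\<close> gives \<open>Or (Or P \<tau>) (friedman \<rho> \<tau>)\<close>, and the
  inner \<open>\<tau>\<close> is absorbed because it implies
  \<open>friedman \<rho> \<tau>\<close>.\<close>

lemma forces_friedman_friedman:
  assumes K: "kripke_model L K" and \<rho>: "sentence_of L {} \<rho>" and \<tau>: "sentence_of L {} \<tau>"
  shows "\<beta> \<in> nodes K \<Longrightarrow>
    forces K \<beta> (friedman (friedman A \<rho>) \<tau>) \<longleftrightarrow> forces K \<beta> (friedman A (friedman \<rho> \<tau>))"
proof (induction A arbitrary: \<beta> rule: fm_height_induct)
  case Bot
  then show ?case using forces_friedman_of_forces[OF K \<tau>] by auto
next
  case (Atom p ts)
  then show ?case using forces_friedman_of_forces[OF K \<tau>] by auto
next
  case (Forall x A)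
  then show ?case
    using \<rho> \<tau> sentence_of_friedman[OF \<rho> \<tau>] by (simp add: inst_friedman sentence_of_def)
next
  case (Exists x A)
  then show ?case
    using \<rho> \<tau> sentence_of_friedman[OF \<rho> \<tau>] by (simp add: inst_friedman sentence_of_def)
qed auto

text \<open>Domains and atomic forcing are kept, so the classical structures at the remaining nodes
  do not change, while implications and universal formulas no longer see the removed nodes.\<close>

definition restrict_nodes :: "('k, 'f, 'p, 'd) kripke \<Rightarrow> 'k set \<Rightarrow> ('k, 'f, 'p, 'd) kripke" where
  "restrict_nodes K N = K\<lparr>nodes := N, leq := leq K \<inter> N \<times> N\<rparr>"

lemma restrict_nodes_simps [simp]:
  "nodes (restrict_nodes K N) = N"
  "leq (restrict_nodes K N) = leq K \<inter> N \<times> N"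
  "dmn (restrict_nodes K N) = dmn K"
  "fun_at (restrict_nodes K N) = fun_at K"
  "frc (restrict_nodes K N) = frc K"
  "struct_at (restrict_nodes K N) = struct_at K"
  by (auto simp: restrict_nodes_def struct_at_def fun_eq_iff)

lemma kripke_model_restrict_nodes:
  assumes "kripke_model L K" and "N \<subseteq> nodes K" and "N \<noteq> {}"
  shows "kripke_model L (restrict_nodes K N)"
proof -
  have "partial_order_on (nodes K) (leq K)"
    using assms(1) by (simp add: kripke_model_def)
  then have "partial_order_on N (leq K \<inter> N \<times> N)"
    using assms(2) unfolding partial_order_on_def preorder_on_def refl_on_def antisym_def trans_def
    by fast
  then show ?thesis
    using assms unfolding kripke_model_def restrict_nodes_simps by blast
qed

text \<open>Nodes outside \<open>N\<close> force every translation, so they impose no condition in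
  the clauses for \<open>Imp\<close> and \<open>Forall\<close>; at nodes of \<open>N\<close> the
  disjunct \<open>\<rho>\<close> fails, so atoms are unaffected.\<close>

lemma forces_friedman_iff:
  assumes K: "kripke_model L K" and \<rho>: "sentence_of L {} \<rho>"
    and N: "N = {\<beta> \<in> nodes K. \<not> forces K \<beta> \<rho>}"
  shows "\<beta> \<in> N \<Longrightarrow> forces K \<beta> (friedman A \<rho>) \<longleftrightarrow> forces (restrict_nodes K N) \<beta> A"
proof -
  have sub: "N \<subseteq> nodes K"
    by (auto simp: N)
  have outside: "forces K \<gamma> (friedman B \<rho>)" if "\<gamma> \<in> nodes K" "\<gamma> \<notin> N" for \<gamma> B
    using forces_friedman_of_forces[OF K \<rho>] that by (auto simp: N)
  show "\<beta> \<in> N \<Longrightarrow> forces K \<beta> (friedman A \<rho>) \<longleftrightarrow> forces (restrict_nodes K N) \<beta> A"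
  proof (induction A arbitrary: \<beta> rule: fm_height_induct)
    case (Imp A B)
    have "(forces K \<gamma> (friedman A \<rho>) \<longrightarrow> forces K \<gamma> (friedman B \<rho>)) \<longleftrightarrow>
        (\<gamma> \<in> N \<longrightarrow> forces (restrict_nodes K N) \<gamma> A \<longrightarrow> forces (restrict_nodes K N) \<gamma> B)"
      if "\<gamma> \<in> nodes K" for \<gamma>
      using Imp.IH[of \<gamma>] outside[OF that] by blast
    then show ?case
      using Imp.prems sub by auto
  next
    case (Forall x A)
    have "forces K \<gamma> (inst x d (friedman A \<rho>)) \<longleftrightarrow>
        (\<gamma> \<in> N \<longrightarrow> forces (restrict_nodes K N) \<gamma> (inst x d A))"
      if "\<gamma> \<in> nodes K" for \<gamma> d
      using Forall.IH[of \<gamma> d] outside[OF that] \<rho> by (auto simp: inst_friedman sentence_of_def)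
    then show ?case
      using Forall.prems sub by auto
  next
    case (Exists x A)
    then show ?case
      using \<rho> by (auto simp: inst_friedman sentence_of_def)
  qed (auto simp: N)
qed

section \<open>Excluded middle with parameters\<close>

text \<open>Simultaneous substitution of names for free variables; \<open>None\<close> leaves a
  variable alone. Names are closed, so nothing can be captured.\<close>

primrec subst_tm :: "(nat \<Rightarrow> 'd option) \<Rightarrow> ('f, 'd) tm \<Rightarrow> ('f, 'd) tm" where
  "subst_tm \<sigma> (Var x) = (case \<sigma> x of None \<Rightarrow> Var x | Some d \<Rightarrow> Cst d)"
| "subst_tm \<sigma> (Cst d) = Cst d"
| "subst_tm \<sigma> (Fn f ts) = Fn f (map (subst_tm \<sigma>) ts)"

primrec subst :: "(nat \<Rightarrow> 'd option) \<Rightarrow> ('f, 'p, 'd) fm \<Rightarrow> ('f, 'p, 'd) fm" where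
  "subst \<sigma> Bot = Bot"
| "subst \<sigma> (Atom p ts) = Atom p (map (subst_tm \<sigma>) ts)"
| "subst \<sigma> (And A B) = And (subst \<sigma> A) (subst \<sigma> B)"
| "subst \<sigma> (Or A B) = Or (subst \<sigma> A) (subst \<sigma> B)"
| "subst \<sigma> (Imp A B) = Imp (subst \<sigma> A) (subst \<sigma> B)"
| "subst \<sigma> (Forall x A) = Forall x (subst (\<sigma>(x := None)) A)"
| "subst \<sigma> (Exists x A) = Exists x (subst (\<sigma>(x := None)) A)"

lemma subst_tm_empty [simp]: "subst_tm Map.empty t = t"
  by (induction t) (auto intro: map_idI)

lemma subst_empty [simp]: "subst Map.empty A = A"
  by (induction A) (auto intro: map_idI simp: fun_upd_idem)

lemma inst_tm_subst_tm: "inst_tm x d (subst_tm (\<sigma>(x := None)) t) = subst_tm (\<sigma>(x \<mapsto> d)) t"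
  by (induction t) (auto split: option.split)

lemma inst_subst: "inst x d (subst (\<sigma>(x := None)) A) = subst (\<sigma>(x \<mapsto> d)) A"
proof (induction A arbitrary: \<sigma>)
  case (Forall y A)
  show ?case
  proof (cases "y = x")
    case False
    then show ?thesis
      using Forall.IH[of "\<sigma>(y := None)"]
      by (simp only: subst.simps inst.simps if_False fun_upd_twist[OF False])
  qed (simp only: subst.simps inst.simps simp_thms if_True fun_upd_upd)
next
  case (Exists y A)
  show ?case
  proof (cases "y = x")
    case False
    then show ?thesis
      using Exists.IH[of "\<sigma>(y := None)"]
      by (simp only: subst.simps inst.simps if_False fun_upd_twist[OF False])
  qed (simp only: subst.simps inst.simps simp_thms if_True fun_upd_upd)
qed (auto simp: inst_tm_subst_tm)

text \<open>Since \<open>\<beta>\<close> lies above itself, each quantifier of the prefix can be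
  opened at \<open>\<beta>\<close>. The arbitrary \<open>\<tau>\<close> records the values given to
  quantifiers already opened.\<close>

lemma forces_foldr_Forall:
  assumes "\<beta> \<in> nodes K" and "(\<beta>, \<beta>) \<in> leq K"
  shows "forces K \<beta> (subst \<tau> (foldr Forall xs A)) \<Longrightarrow> \<forall>x\<in>set xs. \<sigma> x \<in> dmn K \<beta> \<Longrightarrow>
    forces K \<beta> (subst (\<lambda>x. if x \<in> set xs then Some (\<sigma> x) else \<tau> x) A)"
proof (induction xs arbitrary: \<tau>)
  case (Cons x xs)
  have "forces K \<beta> (subst (\<tau>(x \<mapsto> \<sigma> x)) (foldr Forall xs A))"
    using Cons.prems assms by (simp add: inst_subst del: fun_upd_apply)
  then have "forces K \<beta> (subst (\<lambda>y. if y \<in> set xs then Some (\<sigma> y) else (\<tau>(x \<mapsto> \<sigma> x)) y) A)"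
    using Cons.IH[of "\<tau>(x \<mapsto> \<sigma> x)"] Cons.prems(2) by (simp del: fun_upd_apply)
  moreover have "(\<lambda>y. if y \<in> set xs then Some (\<sigma> y) else (\<tau>(x \<mapsto> \<sigma> x)) y) =
      (\<lambda>y. if y \<in> set (x # xs) then Some (\<sigma> y) else \<tau> y)"
    by auto
  ultimately show ?case by simp
qed simp

section \<open>Replacing names by variables\<close>

primrec bv :: "('f, 'p, 'd) fm \<Rightarrow> nat set" where
  "bv Bot = {}"
| "bv (Atom p ts) = {}"
| "bv (And A B) = bv A \<union> bv B"
| "bv (Or A B) = bv A \<union> bv B"
| "bv (Imp A B) = bv A \<union> bv B"
| "bv (Forall x A) = insert x (bv A)"
| "bv (Exists x A) = insert x (bv A)"

text \<open>\<open>PEM L\<close> consists of closures of formulas without names, so parameters are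
  turned into variables before excluded middle is applied to a sentence containing them.\<close>

primrec abstract_tm :: "('d \<Rightarrow> nat) \<Rightarrow> ('f, 'd) tm \<Rightarrow> ('f, 'd) tm" where
  "abstract_tm g (Var x) = Var x"
| "abstract_tm g (Cst d) = Var (g d)"
| "abstract_tm g (Fn f ts) = Fn f (map (abstract_tm g) ts)"

primrec abstract :: "('d \<Rightarrow> nat) \<Rightarrow> ('f, 'p, 'd) fm \<Rightarrow> ('f, 'p, 'd) fm" where
  "abstract g Bot = Bot"
| "abstract g (Atom p ts) = Atom p (map (abstract_tm g) ts)"
| "abstract g (And A B) = And (abstract g A) (abstract g B)"
| "abstract g (Or A B) = Or (abstract g A) (abstract g B)"
| "abstract g (Imp A B) = Imp (abstract g A) (abstract g B)"
| "abstract g (Forall x A) = Forall x (abstract g A)"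
| "abstract g (Exists x A) = Exists x (abstract g A)"

text \<open>
  The set functions \<open>set2_tm\<close> and \<open>set3_fm\<close> of the datatypes collect the elements \<open>d\<close> whose names \<open>Cst d\<close> occur.
\<close>

lemma finite_bv: "finite (bv A)"
  by (induction A) auto

lemma finite_constants_tm: "finite (set2_tm t)"
  by (induction t) auto

lemma finite_constants: "finite (set3_fm A)"
  by (induction A) (auto simp: finite_constants_tm)

lemma constants_tm_subset: "tm_of L U t \<Longrightarrow> set2_tm t \<subseteq> U"
  by (induction t) (auto simp: list_all_iff)

lemma constants_subset: "fm_of L U A \<Longrightarrow> set3_fm A \<subseteq> U"
  using constants_tm_subset by (induction A) (fastforce simp: list_all_iff)+

lemma tm_of_abstract_tm: "tm_of L U t \<Longrightarrow> tm_of L {} (abstract_tm g t)"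
  by (induction t) (auto simp: list_all_iff)

lemma fm_of_abstract: "fm_of L U A \<Longrightarrow> fm_of L {} (abstract g A)"
  by (induction A) (auto simp: list_all_iff intro: tm_of_abstract_tm)

lemma fv_tm_abstract_tm: "fv_tm (abstract_tm g t) = fv_tm t \<union> g ` set2_tm t"
  by (induction t) auto

lemma fv_abstract: "g ` set3_fm A \<inter> bv A = {} \<Longrightarrow> fv (abstract g A) = fv A \<union> g ` set3_fm A"
  by (induction A) (auto simp: fv_tm_abstract_tm)

lemma subst_tm_abstract_tm:
  "\<forall>d\<in>set2_tm t. \<sigma> (g d) = Some d \<Longrightarrow> \<forall>x\<in>fv_tm t. \<sigma> x = None \<Longrightarrow>
    subst_tm \<sigma> (abstract_tm g t) = t"
  by (induction t) (auto intro!: map_idI)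

text \<open>Here \<open>\<sigma>\<close> undoes \<open>g\<close>. Disjointness from the bound
  variables makes the premises survive when \<open>\<sigma>\<close> is reset at a binder.\<close>

lemma subst_abstract:
  "\<forall>d\<in>set3_fm A. \<sigma> (g d) = Some d \<Longrightarrow> g ` set3_fm A \<inter> bv A = {} \<Longrightarrow>
    \<forall>x\<in>fv A. \<sigma> x = None \<Longrightarrow> subst \<sigma> (abstract g A) = A"
proof (induction A arbitrary: \<sigma>)
  case (Atom p ts)
  then show ?case by (auto intro!: map_idI subst_tm_abstract_tm)
next
  case (Forall x A)
  then show ?case by (auto intro!: Forall.IH)
next
  case (Exists x A)
  then show ?case by (auto intro!: Exists.IH)
qed (simp_all add: Int_Un_distrib Int_Un_distrib2 image_Un)

lemma sentence_of_univ_closure: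
  assumes "fm_of L U A"
  shows "sentence_of L U (univ_closure A)"
proof -
  have "fv (foldr Forall xs A) = fv A - set xs" "fm_of L U (foldr Forall xs A)" for xs
    using assms by (induction xs) auto
  then show ?thesis
    by (simp add: sentence_of_def univ_closure_def)
qed

lemma sentence_of_PEM: "C \<in> PEM L \<Longrightarrow> sentence_of L {} C"
  by (auto simp: PEM_def intro!: sentence_of_univ_closure)

text \<open>The parameters of \<open>A\<close> may come from a later domain: the universal closure
  of the abstracted excluded middle persists to \<open>\<beta>\<close> and is instantiated there
  with these parameters.\<close>

lemma excluded_middle_at:
  fixes A :: "('f, 'p, 'd) fm"
  assumes K: "kripke_model L K" and PEM: "\<forall>C\<in>PEM L. forces K \<alpha> C"
    and le: "(\<alpha>, \<beta>) \<in> leq K" and A: "sentence_of L (dmn K \<beta>) A"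
  shows "forces K \<beta> A \<or> forces K \<beta> (Neg A)"
proof -
  obtain f :: "'d \<Rightarrow> nat" where f: "inj_on f (set3_fm A)"
    using finite_imp_inj_to_nat_seg[OF finite_constants[of A]] by blast
  obtain m where m: "\<forall>x\<in>bv A. x < m"
    using finite_nat_set_iff_bounded finite_bv by blast
  \<comment> \<open>Shifting by \<open>m\<close> moves the chosen variables above all bound
    variables of \<open>A\<close>, which excludes capture.\<close>
  define g where "g d = f d + m" for d
  have g: "inj_on g (set3_fm A)" "g ` set3_fm A \<inter> bv A = {}"
    using f m by (auto simp: g_def inj_on_def)
  define B where "B = abstract g A"
  define E where "E = Or B (Neg B)"
  define xs where "xs = sorted_list_of_set (fv E)"
  define \<sigma> where "\<sigma> x = inv_into (set3_fm A) g x" for x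
  have xs: "set xs = g ` set3_fm A"
    using A by (simp add: xs_def E_def B_def fv_abstract[OF g(2)] sentence_of_def)
  have subst: "subst (\<lambda>x. if x \<in> set xs then Some (\<sigma> x) else None) B = A"
    unfolding B_def using A g by (intro subst_abstract) (auto simp: xs \<sigma>_def sentence_of_def)
  have "foldr Forall xs E \<in> PEM L"
    using A unfolding PEM_def univ_closure_def xs_def E_def B_def
    by (auto intro: fm_of_abstract simp: sentence_of_def)
  then have "forces K \<alpha> (foldr Forall xs E)"
    using PEM by blast
  then have "forces K \<beta> (foldr Forall xs E)"
    using forces_mono[OF K le] sentence_of_mono[OF sentence_of_PEM] \<open>foldr Forall xs E \<in> PEM L\<close>
    by blast
  moreover have "\<forall>x\<in>set xs. \<sigma> x \<in> dmn K \<beta>"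
    using A constants_subset[of L "dmn K \<beta>" A] inv_into_into[of _ g "set3_fm A"]
    by (auto simp: xs \<sigma>_def sentence_of_def)
  ultimately have "forces K \<beta> (subst (\<lambda>x. if x \<in> set xs then Some (\<sigma> x) else None) E)"
    using forces_foldr_Forall[of \<beta> K Map.empty xs E \<sigma>] leq_refl[OF K] leq_nodes[OF K le]
    by simp
  then show ?thesis
    by (simp add: E_def subst)
qed

text \<open>Excluded middle at \<open>\<alpha>\<close> makes implication local: if \<open>A\<close>
  is not forced there, \<open>Neg A\<close> is, and no later node forces \<open>A\<close>. The
  universal case needs excluded middle at later nodes too.\<close>

lemma forces_iff_holds:
  assumes K: "kripke_model L K" and \<alpha>: "\<alpha> \<in> nodes K" and PEM: "\<forall>C\<in>PEM L. forces K \<alpha> C"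
  shows "sentence_of L (dmn K \<alpha>) A \<Longrightarrow> forces K \<alpha> A \<longleftrightarrow> holds (struct_at K \<alpha>) A"
proof (induction A rule: fm_height_induct)
  case (Atom p ts)
  then show ?case using K \<alpha> unfolding kripke_model_def forces.simps by blast
next
  case (Imp A B)
  have "forces K \<alpha> (Imp A B) \<longleftrightarrow> (forces K \<alpha> A \<longrightarrow> forces K \<alpha> B)"
    using excluded_middle_at[OF K PEM leq_refl[OF K \<alpha>], of A] forces_mono[OF K, of \<alpha> _ B]
      Imp.prems \<alpha> leq_refl[OF K \<alpha>] by auto
  then show ?case using Imp by simp
next
  case (Forall x A)
  have U: "univ (struct_at K \<alpha>) = dmn K \<alpha>" by (simp add: struct_at_def)
  have "forces K \<alpha> (Forall x A)" if all: "\<forall>d\<in>dmn K \<alpha>. forces K \<alpha> (inst x d A)"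
  proof -
    \<comment> \<open>No element of the domain at \<open>\<alpha>\<close> witnesses
      \<open>?E\<close>, so its negation is forced; this also holds at later nodes and controls the
      new elements there.\<close>
    let ?E = "Exists x (Neg A)"
    have "sentence_of L (dmn K \<alpha>) ?E"
      using Forall.prems by (simp add: sentence_of_def)
    moreover have "\<not> forces K \<alpha> ?E"
      using all leq_refl[OF K \<alpha>] \<alpha> by auto
    ultimately have no: "forces K \<alpha> (Neg ?E)"
      using excluded_middle_at[OF K PEM leq_refl[OF K \<alpha>]] by blast
    show ?thesis
      unfolding forces.simps
    proof (intro ballI impI)
      fix \<beta> d assume \<beta>: "\<beta> \<in> nodes K" "(\<alpha>, \<beta>) \<in> leq K" and d: "d \<in> dmn K \<beta>"
      have "\<not> forces K \<beta> ?E" using no \<beta> by auto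
      then have "\<not> forces K \<beta> (Neg (inst x d A))" using d by auto
      then show "forces K \<beta> (inst x d A)"
        using excluded_middle_at[OF K PEM \<beta>(2)] d
          sentence_of_inst(1)[OF sentence_of_mono[OF Forall.prems dmn_mono[OF K \<beta>(2)]]]
        by blast
    qed
  qed
  then have "forces K \<alpha> (Forall x A) \<longleftrightarrow> (\<forall>d\<in>dmn K \<alpha>. forces K \<alpha> (inst x d A))"
    using leq_refl[OF K \<alpha>] \<alpha> by auto
  then show ?case
    using Forall.IH sentence_of_inst(1)[OF Forall.prems] by (simp add: U)
next
  case (Exists x A)
  then show ?case using sentence_of_inst(2)[OF Exists.prems] by (simp add: struct_at_def)
qed auto

section \<open>Induction on the depth\<close>

text \<open>Nothing lies strictly above \<open>\<beta>\<close>, so \<open>Neg A\<close> is forced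
  there whenever \<open>A\<close> is not.\<close>

lemma forces_PEM_at_maximal:
  assumes max: "\<forall>\<gamma>. (\<beta>, \<gamma>) \<in> leq K \<longrightarrow> \<gamma> = \<beta>" and "C \<in> PEM L"
  shows "forces K \<beta> C"
proof -
  have "forces K \<beta> (subst \<tau> (foldr Forall xs (Or A (Neg A))))" for \<tau> A xs
    using max by (induction xs arbitrary: \<tau>) (auto simp: inst_subst)
  from this[of Map.empty] show ?thesis
    using assms(2) by (auto simp: PEM_def univ_closure_def)
qed

section \<open>Prolonging finite chains\<close>

lemma chain_has_greatest:
  assumes "finite C" and "C \<noteq> {}" and "C \<in> Chains r" and "trans r"
  shows "\<exists>t\<in>C. \<forall>c\<in>C. (c, t) \<in> r"
  using assms(1-3)
proof (induction C rule: finite_ne_induct)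
  case (singleton x)
  then show ?case by (auto simp: Chains_def)
next
  case (insert x C)
  then obtain t where t: "t \<in> C" "\<forall>c\<in>C. (c, t) \<in> r"
    by (auto simp: Chains_def)
  show ?case
  proof (cases "(x, t) \<in> r")
    case True
    with t show ?thesis by auto
  next
    case False
    with insert.prems t(1) have "(t, x) \<in> r" "(x, x) \<in> r" by (auto simp: Chains_def)
    with t \<open>trans r\<close> show ?thesis by (metis insert_iff transD)
  qed
qed

text \<open>This yields the drop in depth: the greatest element of a finite chain without maximal
  nodes has a strictly larger node above it, which prolongs the chain.\<close>

lemma chain_above:
  assumes K: "kripke_model L K" and C: "finite C" "C \<noteq> {}" "C \<in> Chains (leq K)"
    and nonmax: "\<forall>\<beta>\<in>C. \<exists>\<gamma>. (\<beta>, \<gamma>) \<in> leq K \<and> \<gamma> \<noteq> \<beta>"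
  shows "\<exists>\<gamma>. \<gamma> \<notin> C \<and> insert \<gamma> C \<in> Chains (leq K)"
proof -
  have po: "trans (leq K)" "antisym (leq K)"
    using K by (auto simp: kripke_model_def partial_order_on_def preorder_on_def)
  obtain t where t: "t \<in> C" "\<forall>c\<in>C. (c, t) \<in> leq K"
    using chain_has_greatest[OF C po(1)] by blast
  obtain \<gamma> where \<gamma>: "(t, \<gamma>) \<in> leq K" "\<gamma> \<noteq> t"
    using nonmax t(1) by blast
  \<comment> \<open>Otherwise \<open>\<gamma>\<close> would lie below the greatest element
    \<open>t\<close>, and antisymmetry would give equality.\<close>
  have "\<gamma> \<notin> C"
    using \<gamma> t po(2) by (auto dest: antisymD)
  moreover have "(\<gamma>, \<gamma>) \<in> leq K" "\<forall>c\<in>C. (c, \<gamma>) \<in> leq K"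
    using leq_refl[OF K] leq_nodes[OF K \<gamma>(1)] leq_trans[OF K _ \<gamma>(1)] t(2) by auto
  ultimately show ?thesis
    using C(3) by (auto simp: Chains_def)
qed

text \<open>Induction on the bound for chain cardinalities, with the model arbitrary so that the
  hypothesis applies to submodels. That \<open>\<rho>\<close> is a sentence without names is carried
  along because the facts about the translation require it.\<close>

lemma friedman_pow_of_depth:
  assumes "kripke_model L K" and "\<alpha> \<in> nodes K"
    and "\<forall>C\<in>Chains (leq K). finite C \<and> card C \<le> n"
  shows "\<exists>m \<rho>. sentence_of L {} \<rho> \<and> \<rho> \<in> friedman_pow (PEM L) m \<and>
    (\<forall>A. sentence_of L (dmn K \<alpha>) A \<longrightarrow>
      (forces K \<alpha> (friedman A \<rho>) \<longleftrightarrow> holds (struct_at K \<alpha>) A))"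
  using assms
proof (induction n arbitrary: K)
  case 0
  \<comment> \<open>A bound of zero is impossible, since a single node is already a chain.\<close>
  have "{\<alpha>} \<in> Chains (leq K)"
    using leq_refl[OF 0(1,2)] by (simp add: Chains_def)
  with 0(3) show ?case by fastforce
next
  case (Suc n)
  note K = Suc.prems(1) and \<alpha> = Suc.prems(2)
  show ?case
  proof (cases "\<forall>C\<in>PEM L. forces K \<alpha> C")
    case True
    \<comment> \<open>No node forces \<open>Bot\<close>, so translating by \<open>Bot\<close>
      corresponds to the submodel on all nodes, which is \<open>K\<close> itself.\<close>
    have "{\<beta> \<in> nodes K. \<not> forces K \<beta> Bot} = nodes K" by simp
    moreover have "restrict_nodes K (nodes K) = K"
      using leq_nodes[OF K] by (auto simp: restrict_nodes_def intro!: kripke.equality)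
    ultimately have "forces K \<alpha> (friedman A Bot) \<longleftrightarrow> forces K \<alpha> A" for A
      using forces_friedman_iff[OF K, of Bot "nodes K" \<alpha> A] \<alpha> by simp
    then have "sentence_of L {} Bot \<and> Bot \<in> friedman_pow (PEM L) 0 \<and>
      (\<forall>A. sentence_of L (dmn K \<alpha>) A \<longrightarrow>
        (forces K \<alpha> (friedman A Bot) \<longleftrightarrow> holds (struct_at K \<alpha>) A))"
      using forces_iff_holds[OF K \<alpha> True] by simp
    then show ?thesis by blast
  next
    case False
    then obtain C where C: "C \<in> PEM L" "\<not> forces K \<alpha> C" by blast
    note sC = sentence_of_PEM[OF C(1)]
    define N where "N = {\<beta> \<in> nodes K. \<not> forces K \<beta> C}"
    let ?K' = "restrict_nodes K N"
    have N: "\<alpha> \<in> N" "N \<subseteq> nodes K"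
      using \<alpha> C(2) by (auto simp: N_def)
    then have K': "kripke_model L ?K'"
      using kripke_model_restrict_nodes[OF K] by blast
    have "finite X \<and> card X \<le> n" if X: "X \<in> Chains (leq ?K')" for X
    proof (cases "X = {}")
      case False
      have XK: "X \<in> Chains (leq K)" and XN: "X \<subseteq> N"
        using X by (auto simp: Chains_def)
      then have fin: "finite X" using Suc.prems(3) by blast
      \<comment> \<open>A maximal node would force \<open>C\<close>, while no node of
        \<open>N\<close> does.\<close>
      have "\<forall>\<beta>\<in>X. \<exists>\<gamma>. (\<beta>, \<gamma>) \<in> leq K \<and> \<gamma> \<noteq> \<beta>"
        using XN forces_PEM_at_maximal[OF _ C(1), of _ K] by (auto simp: N_def)
      then obtain \<gamma> where "\<gamma> \<notin> X" "insert \<gamma> X \<in> Chains (leq K)"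
        using chain_above[OF K fin False XK] by blast
      then show ?thesis
        using Suc.prems(3) fin by fastforce
    qed simp
    then obtain m \<rho> where \<rho>: "sentence_of L {} \<rho>" "\<rho> \<in> friedman_pow (PEM L) m"
      and iff: "\<And>A. sentence_of L (dmn K \<alpha>) A \<Longrightarrow>
        forces ?K' \<alpha> (friedman A \<rho>) \<longleftrightarrow> holds (struct_at K \<alpha>) A"
      using Suc.IH[OF K'] N(1) by auto
    \<comment> \<open>The translation splits into one by \<open>\<rho>\<close> followed by one by
      \<open>C\<close>; the latter amounts to passing to \<open>?K'\<close>, where the induction
      hypothesis applies.\<close>
    have "forces K \<alpha> (friedman A (friedman \<rho> C)) \<longleftrightarrow> holds (struct_at K \<alpha>) A"
      if "sentence_of L (dmn K \<alpha>) A" for A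
      using forces_friedman_friedman[OF K \<rho>(1) sC \<alpha>] forces_friedman_iff[OF K sC N_def N(1)]
        iff[OF that] by blast
    moreover have "friedman \<rho> C \<in> friedman_pow (PEM L) (Suc m)"
      using \<rho>(2) C(1) by auto
    ultimately show ?thesis
      using sentence_of_friedman[OF \<rho>(1) sC] by blast
  qed
qed

theorem mainTheorem1:
  fixes L :: "('f, 'p) language" and K :: "('k, 'f, 'p, 'd) kripke" and \<alpha> :: 'k
  assumes "kripke_model L K" and "finite_depth K" and "\<alpha> \<in> nodes K"
  shows "\<exists>\<rho>. sentence_of L {} \<rho> \<and> \<rho> \<in> friedman_star (PEM L) \<and>
    (\<forall>A. sentence_of L (dmn K \<alpha>) A \<longrightarrow>
      (forces K \<alpha> (friedman A \<rho>) \<longleftrightarrow> holds (struct_at K \<alpha>) A))"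
proof -
  obtain n where "\<forall>C\<in>Chains (leq K). finite C \<and> card C \<le> n"
    using assms(2) unfolding finite_depth_def by blast
  from friedman_pow_of_depth[OF assms(1,3) this] show ?thesis
    unfolding friedman_star_def by blast
qed

end
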